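(* Let $\alpha>0$, let $\Omega\subset\mathbb{R}^d$ be open and convex, and let $\varphi:\Omega\to\mathbb{R}$ be $\alpha$-exponentially concave and satisfy the regularity conditions of the context. Let $\Omega'=D^{(\alpha)}\varphi(\Omega)$ and let $\psi:\Omega'\to\mathbb{R}$ be the $\alpha$-conjugate of $\varphi$. Then for all $\xi\in\Omega$ and $\eta\in\Omega'$, $$\varphi(\xi)=\min_{\eta'\in\Omega'}\big(c^{(\alpha)}(\xi,\eta')-\psi(\eta')\big),\qquad \psi(\eta)=\min_{\xi'\in\Omega}\big(c^{(\alpha)}(\xi',\eta)-\varphi(\xi')\big).$$ Furthermore, $\psi$ is locally $\alpha$-exponentially concave on $\Omega'$ in the sense that $-D^2\psi-\alpha(D\psi)(D\psi)^\top$ is strictly positive definite on $\Omega'$, and $1-\alpha D\psi(\eta)\cdot\eta>0$ on $\Omega'$, so that the $\alpha$-gradient $D^{(\alpha)}\psi(\eta)=\frac{1}{1-\alpha D\psi(\eta)\cdot\eta}D\psi(\eta)$ is well-defined. Finally, $$(D^{(\alpha)}\varphi)^{-1}=D^{(\alpha)}\psi.$$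
   Context: $D$, $D^2$ are the Euclidean gradient and Hessian. $\varphi$ is $\alpha$-exponentially concave if $e^{\alpha\varphi}$ is concave. Regularity conditions: $\varphi$ is smooth, $-D^2\varphi-\alpha(D\varphi)(D\varphi)^\top$ is strictly positive definite on $\Omega$, and $1-\alpha D\varphi(\xi)\cdot\xi>0$ for all $\xi\in\Omega$. $\alpha$-gradient: $D^{(\alpha)}\varphi(\xi)=\frac{1}{1-\alpha D\varphi(\xi)\cdot\xi}D\varphi(\xi)$, which under these conditions is a diffeomorphism from $\Omega$ onto the open set $\Omega'$. $c^{(\alpha)}(x,y)=\frac1\alpha\log(1+\alpha x\cdot y)$ for $1+\alpha x\cdot y>0$. The $\alpha$-conjugate is $\psi(\eta)=c^{(\alpha)}(\xi,\eta)-\varphi(\xi)$ with $\xi=(D^{(\alpha)}\varphi)^{-1}(\eta)$, $\eta\in\Omega'$. *)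

theory Defs
  imports "HOL-Analysis.Analysis"
begin

primrec C_k_on :: "nat \<Rightarrow> 'a::real_normed_vector set \<Rightarrow> ('a \<Rightarrow> 'b::real_normed_vector) \<Rightarrow> bool"
  where
    "C_k_on 0 S f \<longleftrightarrow> continuous_on S f"
  | "C_k_on (Suc k) S f \<longleftrightarrow> (\<forall>x\<in>S. f differentiable (at x)) \<and>
       (\<forall>v. C_k_on k S (\<lambda>x. frechet_derivative f (at x) v))"

(* Meant for open S only: the derivatives are taken in the ambient space. *)
definition smooth_on :: "'a::real_normed_vector set \<Rightarrow> ('a \<Rightarrow> 'b::real_normed_vector) \<Rightarrow> bool"
  where "smooth_on S f \<longleftrightarrow> (\<forall>k. C_k_on k S f)"

definition grad :: "(real^'n \<Rightarrow> real) \<Rightarrow> real^'n \<Rightarrow> real^'n"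
  where "grad f x = (THE D. GDERIV f x :> D)"

definition hessian :: "(real^'n \<Rightarrow> real) \<Rightarrow> real^'n \<Rightarrow> real^'n^'n"
  where "hessian f x = jacobian (grad f) (at x)"

(* Excludes the junk values of grad and hessian where the derivatives do not exist. *)
definition twice_differentiable_at :: "(real^'n \<Rightarrow> real) \<Rightarrow> real^'n \<Rightarrow> bool"
  where "twice_differentiable_at f x \<longleftrightarrow>
    (\<forall>\<^sub>F y in nhds x. f differentiable (at y)) \<and> grad f differentiable (at x)"

definition outer_product :: "real^'n \<Rightarrow> real^'n \<Rightarrow> real^'n^'n"
  where "outer_product u v = (\<chi> i j. u $ i * v $ j)"

definition pos_definite :: "real^'n^'n \<Rightarrow> bool"
  where "pos_definite A \<longleftrightarrow> transpose A = A \<and> (\<forall>v. v \<noteq> 0 \<longrightarrow> v \<bullet> (A *v v) > 0)"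

definition exp_concave_on :: "real \<Rightarrow> (real^'n) set \<Rightarrow> (real^'n \<Rightarrow> real) \<Rightarrow> bool"
  where "exp_concave_on \<alpha> S f \<longleftrightarrow> concave_on S (\<lambda>x. exp (\<alpha> * f x))"

definition exp_concavity_matrix :: "real \<Rightarrow> (real^'n \<Rightarrow> real) \<Rightarrow> real^'n \<Rightarrow> real^'n^'n"
  where "exp_concavity_matrix \<alpha> f x = - hessian f x - \<alpha> *\<^sub>R outer_product (grad f x) (grad f x)"

definition alpha_grad :: "real \<Rightarrow> (real^'n \<Rightarrow> real) \<Rightarrow> real^'n \<Rightarrow> real^'n"
  where "alpha_grad \<alpha> f x = (1 / (1 - \<alpha> * (grad f x \<bullet> x))) *\<^sub>R grad f x"

(* Only meaningful if 1 + \<alpha> * (x \<bullet> y) > 0. *)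
definition log_cost :: "real \<Rightarrow> real^'n \<Rightarrow> real^'n \<Rightarrow> real"
  where "log_cost \<alpha> x y = (1 / \<alpha>) * ln (1 + \<alpha> * (x \<bullet> y))"

(* Only meaningful for y in the image of S, and if alpha_grad is injective on S. *)
definition alpha_conjugate :: "real \<Rightarrow> (real^'n) set \<Rightarrow> (real^'n \<Rightarrow> real) \<Rightarrow> real^'n \<Rightarrow> real"
  where "alpha_conjugate \<alpha> S f y =
    (let x = inv_into S (alpha_grad \<alpha> f) y in log_cost \<alpha> x y - f x)"

definition is_minimum :: "('a \<Rightarrow> real) \<Rightarrow> 'a set \<Rightarrow> real \<Rightarrow> bool"
  where "is_minimum f S m \<longleftrightarrow> (\<exists>x\<in>S. f x = m) \<and> (\<forall>x\<in>S. m \<le> f x)"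

lemma grad_eqI:
  fixes f :: "real^'n \<Rightarrow> real"
  assumes "GDERIV f x :> D"
  shows "grad f x = D"
  unfolding grad_def
proof (rule the_equality)
  show "GDERIV f x :> D" by (fact assms)
next
  fix E assume "GDERIV f x :> E"
  then have "(\<lambda>h. h \<bullet> E) = (\<lambda>h. h \<bullet> D)"
    using assms unfolding gderiv_def by (rule has_derivative_unique)
  then show "E = D"
    by (metis vector_eq_rdot inner_commute)
qed

lemma GDERIV_grad:
  fixes f :: "real^'n \<Rightarrow> real"
  assumes "f differentiable (at x)"
  shows "GDERIV f x :> grad f x"
proof -
  obtain f' where f': "(f has_derivative f') (at x)"
    using assms unfolding differentiable_def by blast
  have "f' h = h \<bullet> adjoint f' 1" for h
    using adjoint_works[OF has_derivative_linear[OF f'], of h 1] by simp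
  then have "f' = (\<lambda>h. h \<bullet> adjoint f' 1)" ..
  then have "GDERIV f x :> adjoint f' 1"
    using f' unfolding gderiv_def by simp
  then show ?thesis using grad_eqI by metis
qed

end

theory Submission
  imports Defs
begin

text \<open>
  Put \<open>F = exp (\<alpha> * \<phi>)\<close>. Its Hessian is \<open>- \<alpha> F M\<close> with \<open>M\<close> the exponential concavity
  matrix of \<open>\<phi>\<close>, so along segments \<open>F\<close> lies strictly below its tangents: for \<open>\<xi> \<noteq> \<xi>\<^sub>0\<close>,
  \<open>0 < F \<xi> / F \<xi>\<^sub>0 < 1 + \<alpha> D\<phi>(\<xi>\<^sub>0) \<cdot> (\<xi> - \<xi>\<^sub>0)\<close>. With \<open>\<eta>\<close> the \<open>\<alpha>\<close>-gradient at \<open>\<xi>\<^sub>0\<close>, the right-hand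
  side is \<open>(1 + \<alpha> \<xi> \<cdot> \<eta>) / (1 + \<alpha> \<xi>\<^sub>0 \<cdot> \<eta>)\<close>; taking logarithms, \<open>\<xi>\<^sub>0\<close> is the unique minimiser of
  \<open>c(-, \<eta>) - \<phi>\<close>. This yields both minimum formulas and the injectivity of the \<open>\<alpha>\<close>-gradient.

  The derivative of the \<open>\<alpha>\<close>-gradient at \<open>\<xi>\<close> is \<open>- q (I + \<alpha> \<eta> \<xi>\<^sup>T) M\<close> with \<open>q = 1 + \<alpha> \<xi> \<cdot> \<eta>\<close>, which is
  invertible; hence the inverse is differentiable, and by the envelope argument
  \<open>D\<psi>(\<eta>) = \<xi> / q\<close>. Differentiating this once more shows that the matrix of \<open>\<psi>\<close> at \<open>\<eta>\<close> is congruent to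
  that of \<open>\<phi>\<close> at \<open>\<xi>\<close> via the derivative of the inverse.
\<close>

section \<open>Quadratic forms and second derivatives\<close>

lemma exp_concavity_matrix_mult:
  "exp_concavity_matrix \<alpha> f x *v h = - (hessian f x *v h) - (\<alpha> * (grad f x \<bullet> h)) *\<^sub>R grad f x"
proof -
  have 1: "outer_product u v *v h = (v \<bullet> h) *\<^sub>R u" for u v :: "real^'a"
    by (simp add: vec_eq_iff outer_product_def matrix_vector_mult_def inner_vec_def
        sum_distrib_left sum_distrib_right mult_ac)
  have 2: "(- A) *v h = - (A *v h)" for A :: "real^'a^'a"
    by (simp add: vec_eq_iff matrix_vector_mult_def sum_negf)
  show ?thesis
    by (simp add: exp_concavity_matrix_def matrix_vector_mult_diff_rdistrib 1 2
        flip: scaleR_matrix_vector_assoc)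
qed

text \<open>Symmetry stated through the bilinear form carries over directly along a congruence,
  which is how \<open>pos_definite_psi\<close> uses it.\<close>

lemma pos_definite_iff:
  "pos_definite A \<longleftrightarrow>
    (\<forall>u v. u \<bullet> (A *v v) = v \<bullet> (A *v u)) \<and> (\<forall>v. v \<noteq> 0 \<longrightarrow> v \<bullet> (A *v v) > 0)"
proof -
  have "transpose A = A \<longleftrightarrow> (\<forall>u v. u \<bullet> (A *v v) = v \<bullet> (A *v u))"
  proof
    assume "transpose A = A"
    then show "\<forall>u v. u \<bullet> (A *v v) = v \<bullet> (A *v u)"
      by (metis dot_lmul_matrix inner_commute vector_transpose_matrix)
  next
    assume *: "\<forall>u v. u \<bullet> (A *v v) = v \<bullet> (A *v u)"
    have "(transpose A *v u) \<bullet> v = (A *v u) \<bullet> v" for u v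
      using * by (metis dot_lmul_matrix inner_commute transpose_matrix_vector)
    then show "transpose A = A"
      by (metis matrix_eq vector_eq_rdot)
  qed
  then show ?thesis by (simp add: pos_definite_def)
qed

lemma has_derivative_grad:
  assumes "grad f differentiable (at x)"
  shows "(grad f has_derivative (\<lambda>h. hessian f x *v h)) (at x)"
  using assms unfolding hessian_def jacobian_works .

lemma smooth_on_imp_differentiable:
  assumes "smooth_on S f" "x \<in> S"
  shows "f differentiable (at x)"
proof -
  have "C_k_on (Suc 0) S f" using assms by (simp only: smooth_on_def)
  then show ?thesis using assms(2) by simp
qed

text \<open>The directional derivatives in \<open>C_k_on\<close> agree with
  \<open>grad f x \<bullet> v\<close> on the open set \<open>S\<close>, and a vector field is
  differentiable once its components are.\<close>

lemma smooth_on_imp_grad_differentiable: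
  fixes f :: "real^'n \<Rightarrow> real"
  assumes "smooth_on S f" "open S" "x \<in> S"
  shows "grad f differentiable (at x)"
proof -
  have "C_k_on (Suc (Suc 0)) S f" using assms by (simp only: smooth_on_def)
  then have D: "(\<lambda>x. frechet_derivative f (at x) v) differentiable (at x)" for v
    using assms(3) by simp
  have eq: "frechet_derivative f (at y) v = grad f y \<bullet> v" if "y \<in> S" for y v
    using frechet_derivative_at[of f _ y]
      GDERIV_grad[OF smooth_on_imp_differentiable[OF assms(1) that]]
    by (metis gderiv_def inner_commute)
  have "(\<lambda>x. grad f x \<bullet> v) differentiable (at x)" for v
    using D[of v] assms(2,3) eq has_derivative_transform_within_open
    unfolding differentiable_def by (metis (no_types, lifting))
  then show ?thesis
    using differentiable_componentwise_within[of "grad f" x UNIV] by simp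
qed

locale regular_exp_concave =
  fixes \<alpha> :: real and \<Omega> :: "(real^'n) set" and \<phi> :: "real^'n \<Rightarrow> real"
  assumes alpha_pos: "\<alpha> > 0"
    and open_domain: "open \<Omega>"
    and convex_domain: "convex \<Omega>"
    and phi_differentiable: "\<xi> \<in> \<Omega> \<Longrightarrow> \<phi> differentiable (at \<xi>)"
    and grad_phi_differentiable: "\<xi> \<in> \<Omega> \<Longrightarrow> grad \<phi> differentiable (at \<xi>)"
    and pos_definite_phi: "\<xi> \<in> \<Omega> \<Longrightarrow> pos_definite (exp_concavity_matrix \<alpha> \<phi> \<xi>)"
    and denominator_pos: "\<xi> \<in> \<Omega> \<Longrightarrow> 1 - \<alpha> * (grad \<phi> \<xi> \<bullet> \<xi>) > 0"
begin

abbreviation "T \<equiv> alpha_grad \<alpha> \<phi>"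
abbreviation "T_inv \<equiv> inv_into \<Omega> T"
abbreviation "M \<equiv> exp_concavity_matrix \<alpha> \<phi>"

section \<open>Strict tangent inequality and minimality\<close>

lemma below_tangent:
  assumes "\<xi> \<in> \<Omega>" "\<xi>0 \<in> \<Omega>" "\<xi> \<noteq> \<xi>0"
  shows "exp (\<alpha> * (\<phi> \<xi> - \<phi> \<xi>0)) < 1 + \<alpha> * (grad \<phi> \<xi>0 \<bullet> (\<xi> - \<xi>0))"
proof -
  define v where "v = \<xi> - \<xi>0"
  define p where "p t = \<xi>0 + t *\<^sub>R v" for t
  define u where "u t = exp (\<alpha> * \<phi> (p t))" for t
  define u' where "u' t = \<alpha> * (grad \<phi> (p t) \<bullet> v) * u t" for t
  have p_in: "p t \<in> \<Omega>" if "0 \<le> t" "t \<le> 1" for t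
  proof -
    have "p t = (1 - t) *\<^sub>R \<xi>0 + t *\<^sub>R \<xi>" by (simp add: p_def v_def algebra_simps)
    then show ?thesis using convexD_alt[OF convex_domain assms(2,1)] that by simp
  qed
  have p': "(p has_derivative (\<lambda>h. h *\<^sub>R v)) (at t)" for t
    unfolding p_def by (auto intro!: derivative_eq_intros)
  have DERIV_u: "(u has_real_derivative u' t) (at t)" if "0 \<le> t" "t \<le> 1" for t
  proof -
    have "((\<phi> \<circ> p) has_derivative (\<lambda>h. h \<bullet> grad \<phi> (p t)) \<circ> (\<lambda>h. h *\<^sub>R v)) (at t)"
      by (rule diff_chain_at[OF p'])
        (use GDERIV_grad[OF phi_differentiable[OF p_in[OF that]]] in \<open>simp add: gderiv_def\<close>)
    then have "((\<lambda>t. \<phi> (p t)) has_real_derivative grad \<phi> (p t) \<bullet> v) (at t)"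
      by (simp add: has_field_derivative_def o_def mult_commute_abs inner_commute)
    then show ?thesis
      unfolding u_def u'_def by (auto intro!: derivative_eq_intros)
  qed
  \<comment> \<open>The Hessian term and the square of \<open>grad \<phi> (p t) \<bullet> v\<close>
    from the product rule combine into the quadratic form of \<open>M\<close>.\<close>
  have DERIV_u': "(u' has_real_derivative - \<alpha> * u t * (v \<bullet> (M (p t) *v v))) (at t)"
    if "0 \<le> t" "t \<le> 1" for t
  proof -
    have "((grad \<phi> \<circ> p) has_derivative (\<lambda>h. hessian \<phi> (p t) *v h) \<circ> (\<lambda>h. h *\<^sub>R v)) (at t)"
      by (rule diff_chain_at[OF p' has_derivative_grad[OF grad_phi_differentiable[OF p_in[OF that]]]])
    then have "((\<lambda>t. grad \<phi> (p t)) has_derivative (\<lambda>h. h *\<^sub>R (hessian \<phi> (p t) *v v))) (at t)"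
      by (simp add: o_def matrix_vector_mult_scaleR)
    then have "((\<lambda>t. grad \<phi> (p t) \<bullet> v) has_derivative (\<lambda>h. h *\<^sub>R (hessian \<phi> (p t) *v v) \<bullet> v)) (at t)"
      by (rule has_derivative_inner_left)
    then have "((\<lambda>t. grad \<phi> (p t) \<bullet> v) has_real_derivative (hessian \<phi> (p t) *v v) \<bullet> v) (at t)"
      by (simp add: has_field_derivative_def mult_commute_abs)
    from DERIV_mult[OF DERIV_cmult[OF this, of \<alpha>] DERIV_u[OF that]]
    show ?thesis
      unfolding u'_def[abs_def]
      by (rule DERIV_cong)
        (simp add: u'_def exp_concavity_matrix_mult inner_diff_right inner_commute[of v] algebra_simps)
  qed
  \<comment> \<open>The mean value theorem is applied twice, to \<open>u\<close> on [0,1] and to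
    \<open>u'\<close> on [0,r]; as r > 0, the negative second derivative gives a strict
    inequality.\<close>
  obtain r where r: "0 < r" "r < 1" "u 1 - u 0 = u' r"
    using MVT2[of 0 1 u u'] DERIV_u by auto
  obtain s where s: "0 < s" "s < r"
    "u' r - u' 0 = (r - 0) * (- \<alpha> * u s * (v \<bullet> (M (p s) *v v)))"
    using MVT2[of 0 r u' "\<lambda>t. - \<alpha> * u t * (v \<bullet> (M (p t) *v v))"] DERIV_u' r by auto
  have "v \<noteq> 0" using assms(3) by (simp add: v_def)
  then have "v \<bullet> (M (p s) *v v) > 0"
    using pos_definite_phi[OF p_in[of s]] s r by (simp add: pos_definite_def)
  moreover have "u s > 0" by (simp add: u_def)
  ultimately have "r * (\<alpha> * u s * (v \<bullet> (M (p s) *v v))) > 0"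
    using r alpha_pos by simp
  then have "u' r < u' 0" using s by simp
  then have "u 1 < u 0 * (1 + \<alpha> * (grad \<phi> \<xi>0 \<bullet> v))"
    using r by (simp add: u'_def p_def algebra_simps)
  moreover have "u 0 > 0" by (simp add: u_def)
  ultimately have "u 1 / u 0 < 1 + \<alpha> * (grad \<phi> \<xi>0 \<bullet> v)"
    by (simp only: pos_divide_less_eq mult.commute)
  then show ?thesis
    by (simp add: u_def p_def v_def exp_diff right_diff_distrib)
qed

text \<open>For \<open>\<xi> = \<xi>0\<close> the numerator is 1, so dividing the general value by
  this one leaves exactly the bound of \<open>below_tangent\<close>.\<close>

lemma one_plus_inner_T:
  assumes "\<xi>0 \<in> \<Omega>"
  shows "1 + \<alpha> * (\<xi> \<bullet> T \<xi>0)
    = (1 + \<alpha> * (grad \<phi> \<xi>0 \<bullet> (\<xi> - \<xi>0))) / (1 - \<alpha> * (grad \<phi> \<xi>0 \<bullet> \<xi>0))"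
  using denominator_pos[OF assms]
  by (simp add: alpha_grad_def inner_commute[of \<xi>] inner_diff_right field_simps)

lemma one_plus_inner_T_self:
  assumes "\<xi> \<in> \<Omega>"
  shows "1 + \<alpha> * (\<xi> \<bullet> T \<xi>) = 1 / (1 - \<alpha> * (grad \<phi> \<xi> \<bullet> \<xi>))"
  using one_plus_inner_T[OF assms, of \<xi>] by simp

text \<open>The tangent bound exceeds an exponential. This keeps \<open>log_cost\<close> meaningful
  for every pair, not only for matching points.\<close>

lemma one_plus_inner_T_pos:
  assumes "\<xi> \<in> \<Omega>" "\<xi>0 \<in> \<Omega>"
  shows "1 + \<alpha> * (\<xi> \<bullet> T \<xi>0) > 0"
proof -
  have "1 + \<alpha> * (grad \<phi> \<xi>0 \<bullet> (\<xi> - \<xi>0)) > 0"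
  proof (cases "\<xi> = \<xi>0")
    case False
    then show ?thesis
      using less_trans[OF exp_gt_zero below_tangent[OF assms]] by blast
  qed simp
  then show ?thesis
    using denominator_pos[OF assms(2)] by (simp add: one_plus_inner_T[OF assms(2)])
qed

lemma strict_minimum:
  assumes "\<xi> \<in> \<Omega>" "\<xi>0 \<in> \<Omega>" "\<xi> \<noteq> \<xi>0"
  shows "log_cost \<alpha> \<xi>0 (T \<xi>0) - \<phi> \<xi>0 < log_cost \<alpha> \<xi> (T \<xi>0) - \<phi> \<xi>"
proof -
  let ?b = "1 + \<alpha> * (grad \<phi> \<xi>0 \<bullet> (\<xi> - \<xi>0))"
  note lt = below_tangent[OF assms]
  then have b: "?b > 0" using less_trans[OF exp_gt_zero] by blast
  then have "\<alpha> * (\<phi> \<xi> - \<phi> \<xi>0) < ln ?b"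
    using lt by (metis exp_less_cancel_iff exp_ln)
  \<comment> \<open>Both logarithms on the right contain the same denominator, which
    cancels.\<close>
  also have "\<dots> = ln (1 + \<alpha> * (\<xi> \<bullet> T \<xi>0)) - ln (1 + \<alpha> * (\<xi>0 \<bullet> T \<xi>0))"
    using b denominator_pos[OF assms(2)]
    by (simp only: one_plus_inner_T[OF assms(2)]) (simp add: ln_div)
  finally have "\<phi> \<xi> - \<phi> \<xi>0 < (ln (1 + \<alpha> * (\<xi> \<bullet> T \<xi>0)) - ln (1 + \<alpha> * (\<xi>0 \<bullet> T \<xi>0))) / \<alpha>"
    using alpha_pos by (simp add: pos_less_divide_eq mult.commute)
  then show ?thesis
    by (simp add: log_cost_def diff_divide_distrib)
qed

lemma minimum:
  assumes "\<xi> \<in> \<Omega>" "\<xi>0 \<in> \<Omega>"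
  shows "log_cost \<alpha> \<xi>0 (T \<xi>0) - \<phi> \<xi>0 \<le> log_cost \<alpha> \<xi> (T \<xi>0) - \<phi> \<xi>"
  using strict_minimum[OF assms] by (cases "\<xi> = \<xi>0") auto

text \<open>Two distinct points with a common image would each be the strict minimiser of the same
  function.\<close>

lemma inj_on_T: "inj_on T \<Omega>"
proof (rule inj_onI, rule ccontr)
  fix x y assume "x \<in> \<Omega>" "y \<in> \<Omega>" "T x = T y" "x \<noteq> y"
  then show False using strict_minimum[of x y] strict_minimum[of y x] by simp
qed

lemma T_inv_T: "\<xi> \<in> \<Omega> \<Longrightarrow> T_inv (T \<xi>) = \<xi>"
  by (rule inv_into_f_f[OF inj_on_T])

section \<open>Differentiating the \<alpha>-gradient and its inverse\<close>

definition DT :: "real^'n \<Rightarrow> real^'n \<Rightarrow> real^'n"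
  where "DT \<xi> h = - (1 + \<alpha> * (\<xi> \<bullet> T \<xi>)) *\<^sub>R (M \<xi> *v h + (\<alpha> * (\<xi> \<bullet> (M \<xi> *v h))) *\<^sub>R T \<xi>)"

lemma has_derivative_T:
  assumes "\<xi> \<in> \<Omega>"
  shows "(T has_derivative DT \<xi>) (at \<xi>)"
proof -
  let ?s = "1 - \<alpha> * (grad \<phi> \<xi> \<bullet> \<xi>)"
  note g' = has_derivative_grad[OF grad_phi_differentiable[OF assms]]
  have s: "?s > 0" by (rule denominator_pos[OF assms])
  have "(T has_derivative (\<lambda>h. (1 / ?s) *\<^sub>R (hessian \<phi> \<xi> *v h)
      + (\<alpha> * (grad \<phi> \<xi> \<bullet> h + (hessian \<phi> \<xi> *v h) \<bullet> \<xi>) / ?s\<^sup>2) *\<^sub>R grad \<phi> \<xi>)) (at \<xi>)"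
    unfolding alpha_grad_def[abs_def] using s
    by (auto intro!: derivative_eq_intros g' simp: power2_eq_square field_simps)
  also have "(\<lambda>h. (1 / ?s) *\<^sub>R (hessian \<phi> \<xi> *v h)
      + (\<alpha> * (grad \<phi> \<xi> \<bullet> h + (hessian \<phi> \<xi> *v h) \<bullet> \<xi>) / ?s\<^sup>2) *\<^sub>R grad \<phi> \<xi>) = DT \<xi>"
  proof
    fix h
    define g m where "g = grad \<phi> \<xi>" and "m = M \<xi> *v h"
    have H: "hessian \<phi> \<xi> *v h = - m - (\<alpha> * (g \<bullet> h)) *\<^sub>R g"
      by (simp add: m_def g_def exp_concavity_matrix_mult)
    \<comment> \<open>After the Hessian is expressed by \<open>m\<close> and \<open>g\<close>, all
      terms with \<open>g \<bullet> h\<close> cancel because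
      \<open>?s = 1 - \<alpha> * (g \<bullet> \<xi>)\<close>.\<close>
    have coeff: "- (\<alpha> * (g \<bullet> h)) / ?s + \<alpha> * (g \<bullet> h + (hessian \<phi> \<xi> *v h) \<bullet> \<xi>) / ?s\<^sup>2
        = - \<alpha> * (\<xi> \<bullet> m) / ?s\<^sup>2"
    proof -
      have "- (\<alpha> * (g \<bullet> h)) / ?s = - (\<alpha> * (g \<bullet> h)) * ?s / ?s\<^sup>2"
        using s by (simp add: power2_eq_square)
      moreover have "- (\<alpha> * (g \<bullet> h)) * ?s + \<alpha> * (g \<bullet> h + (hessian \<phi> \<xi> *v h) \<bullet> \<xi>) = - \<alpha> * (\<xi> \<bullet> m)"
        by (simp add: H g_def inner_diff_left inner_commute[of \<xi>] algebra_simps)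
      ultimately show ?thesis by (simp only: flip: add_divide_distrib)
    qed
    have "(1 / ?s) *\<^sub>R (hessian \<phi> \<xi> *v h)
      + (\<alpha> * (grad \<phi> \<xi> \<bullet> h + (hessian \<phi> \<xi> *v h) \<bullet> \<xi>) / ?s\<^sup>2) *\<^sub>R grad \<phi> \<xi>
      = - (1 / ?s) *\<^sub>R m
      + (- (\<alpha> * (g \<bullet> h)) / ?s + \<alpha> * (g \<bullet> h + (hessian \<phi> \<xi> *v h) \<bullet> \<xi>) / ?s\<^sup>2) *\<^sub>R g"
      unfolding g_def[symmetric] scaleR_left.add
      by (subst H) (simp add: scaleR_right_diff_distrib)
    also have "\<dots> = DT \<xi> h"
      unfolding coeff DT_def one_plus_inner_T_self[OF assms]
      by (simp add: alpha_grad_def m_def g_def scaleR_right_distrib power2_eq_square)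
    finally show "(1 / ?s) *\<^sub>R (hessian \<phi> \<xi> *v h)
      + (\<alpha> * (grad \<phi> \<xi> \<bullet> h + (hessian \<phi> \<xi> *v h) \<bullet> \<xi>) / ?s\<^sup>2) *\<^sub>R grad \<phi> \<xi> = DT \<xi> h" .
  qed
  finally show ?thesis .
qed

lemma bij_DT:
  assumes "\<xi> \<in> \<Omega>"
  shows "bij (DT \<xi>)"
proof -
  have lin: "linear (DT \<xi>)" by (rule has_derivative_linear[OF has_derivative_T[OF assms]])
  have "h = 0" if "DT \<xi> h = 0" for h
  proof -
    let ?m = "M \<xi> *v h" and ?q = "1 + \<alpha> * (\<xi> \<bullet> T \<xi>)"
    have q: "?q > 0" by (rule one_plus_inner_T_pos[OF assms assms])
    then have 0: "?m + (\<alpha> * (\<xi> \<bullet> ?m)) *\<^sub>R T \<xi> = 0" using that by (simp add: DT_def)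
    \<comment> \<open>Pairing with \<open>\<xi>\<close> reduces the vector equation to a scalar one
      with the nonzero factor \<open>?q\<close>.\<close>
    then have "\<xi> \<bullet> (?m + (\<alpha> * (\<xi> \<bullet> ?m)) *\<^sub>R T \<xi>) = 0" by simp
    then have "?q * (\<xi> \<bullet> ?m) = 0" by (simp add: inner_right_distrib algebra_simps)
    then have "?m = 0" using 0 q by simp
    then show "h = 0"
      using pos_definite_phi[OF assms] unfolding pos_definite_def by (metis inner_zero_right less_irrefl)
  qed
  then have "inj (DT \<xi>)" using linear_injective_0[OF lin] by blast
  then show ?thesis using linear_injective_imp_surjective[OF lin] by (simp add: bij_def)
qed

lemma open_image_T: "open (T ` \<Omega>)"
proof (rule invariance_of_domain[OF _ open_domain inj_on_T])
  show "continuous_on \<Omega> T"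
    using has_derivative_T has_derivative_continuous continuous_at_imp_continuous_on by blast
qed

text \<open>This form of the inverse function theorem takes a global left inverse on the open
  domain, here from injectivity, and asks for no continuity of \<open>DT\<close>.\<close>

lemma has_derivative_T_inv:
  assumes "\<xi> \<in> \<Omega>"
  shows "(T_inv has_derivative inv (DT \<xi>)) (at (T \<xi>))"
proof (rule has_derivative_inverse_on[where f' = DT and g' = "\<lambda>x. inv (DT x)"])
  show "DT \<xi> \<circ> inv (DT \<xi>) = id"
    by (rule iffD1[OF surj_iff bij_is_surj[OF bij_DT[OF assms]]])
qed (use assms open_domain has_derivative_T T_inv_T in auto)

section \<open>The conjugate: duality and first derivative\<close>

context
  fixes \<psi> :: "real^'n \<Rightarrow> real"
  assumes conjugate: "\<And>\<eta>. \<eta> \<in> T ` \<Omega> \<Longrightarrow> \<psi> \<eta> = alpha_conjugate \<alpha> \<Omega> \<phi> \<eta>"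
begin

lemma psi_T:
  assumes "\<xi> \<in> \<Omega>"
  shows "\<psi> (T \<xi>) = log_cost \<alpha> \<xi> (T \<xi>) - \<phi> \<xi>"
  using conjugate[of "T \<xi>"] assms by (simp add: alpha_conjugate_def T_inv_T)

text \<open>By \<open>psi_T\<close> both duality formulas rest on the inequality
  \<open>minimum\<close>: here the base point varies and \<open>\<xi>\<close> is fixed, in
  \<open>is_minimum_psi\<close> the reverse.\<close>

lemma is_minimum_phi:
  assumes "\<xi> \<in> \<Omega>"
  shows "is_minimum (\<lambda>\<eta>. log_cost \<alpha> \<xi> \<eta> - \<psi> \<eta>) (T ` \<Omega>) (\<phi> \<xi>)"
proof -
  have "\<phi> \<xi> \<le> log_cost \<alpha> \<xi> (T x) - \<psi> (T x)" if "x \<in> \<Omega>" for x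
    using minimum[OF assms that] psi_T[OF that] by simp
  moreover have "log_cost \<alpha> \<xi> (T \<xi>) - \<psi> (T \<xi>) = \<phi> \<xi>"
    using psi_T[OF assms] by simp
  ultimately show ?thesis
    using assms unfolding is_minimum_def by blast
qed

lemma is_minimum_psi:
  assumes "\<xi> \<in> \<Omega>"
  shows "is_minimum (\<lambda>x. log_cost \<alpha> x (T \<xi>) - \<phi> x) \<Omega> (\<psi> (T \<xi>))"
  using minimum[OF _ assms] psi_T[OF assms] assms unfolding is_minimum_def by auto

text \<open>Envelope argument: the terms containing the derivative of \<open>T_inv\<close> cancel, since \<open>\<xi>\<close> is a
  critical point of \<open>log_cost \<alpha> - (T \<xi>) - \<phi>\<close>.\<close>

lemma GDERIV_psi:
  assumes "\<xi> \<in> \<Omega>"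
  shows "GDERIV \<psi> (T \<xi>) :> (1 / (1 + \<alpha> * (\<xi> \<bullet> T \<xi>))) *\<^sub>R \<xi>"
proof -
  let ?A = "inv (DT \<xi>)" and ?q = "1 + \<alpha> * (\<xi> \<bullet> T \<xi>)"
  have q: "?q > 0" by (rule one_plus_inner_T_pos[OF assms assms])
  have g: "grad \<phi> \<xi> = (1 / ?q) *\<^sub>R T \<xi>"
    using denominator_pos[OF assms] unfolding one_plus_inner_T_self[OF assms]
    by (simp add: alpha_grad_def)
  have S': "(T_inv has_derivative ?A) (at (T \<xi>))" by (rule has_derivative_T_inv[OF assms])
  have "((\<phi> \<circ> T_inv) has_derivative (\<lambda>h. h \<bullet> grad \<phi> \<xi>) \<circ> ?A) (at (T \<xi>))"
    by (rule diff_chain_at[OF S'])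
      (use GDERIV_grad[OF phi_differentiable[OF assms]] in \<open>simp add: gderiv_def T_inv_T[OF assms]\<close>)
  then have phi': "((\<lambda>\<eta>. \<phi> (T_inv \<eta>)) has_derivative (\<lambda>k. ?A k \<bullet> grad \<phi> \<xi>)) (at (T \<xi>))"
    by (simp add: o_def)
  have q': "((\<lambda>\<eta>. 1 + \<alpha> * (T_inv \<eta> \<bullet> \<eta>)) has_derivative
      (\<lambda>k. \<alpha> * (\<xi> \<bullet> k + ?A k \<bullet> T \<xi>))) (at (T \<xi>))"
    by (auto intro!: derivative_eq_intros S' simp: T_inv_T[OF assms])
  have "((\<lambda>\<eta>. ln (1 + \<alpha> * (T_inv \<eta> \<bullet> \<eta>))) has_derivative
      (\<lambda>k. \<alpha> * (\<xi> \<bullet> k + ?A k \<bullet> T \<xi>) * (1 / ?q))) (at (T \<xi>))"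
    using has_derivative_ln[OF _ q'] q by (simp add: T_inv_T[OF assms] divide_inverse)
  from has_derivative_diff[OF has_derivative_mult_right[OF this, of "1 / \<alpha>"] phi']
  have "((\<lambda>\<eta>. log_cost \<alpha> (T_inv \<eta>) \<eta> - \<phi> (T_inv \<eta>)) has_derivative
      (\<lambda>k. 1 / \<alpha> * (\<alpha> * (\<xi> \<bullet> k + ?A k \<bullet> T \<xi>) * (1 / ?q)) - ?A k \<bullet> grad \<phi> \<xi>)) (at (T \<xi>))"
    by (simp only: log_cost_def)
  also have "(\<lambda>k. 1 / \<alpha> * (\<alpha> * (\<xi> \<bullet> k + ?A k \<bullet> T \<xi>) * (1 / ?q)) - ?A k \<bullet> grad \<phi> \<xi>)
      = (\<lambda>k. k \<bullet> (1 / ?q) *\<^sub>R \<xi>)"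
    using alpha_pos by (simp add: g inner_commute add_divide_distrib)
  finally have "((\<lambda>\<eta>. log_cost \<alpha> (T_inv \<eta>) \<eta> - \<phi> (T_inv \<eta>)) has_derivative
      (\<lambda>k. k \<bullet> (1 / ?q) *\<^sub>R \<xi>)) (at (T \<xi>))" .
  \<comment> \<open>\<open>\<psi>\<close> is prescribed only on the image of \<open>T\<close>;
    openness of the image lets the derivative pass to it.\<close>
  then have "(\<psi> has_derivative (\<lambda>k. k \<bullet> (1 / ?q) *\<^sub>R \<xi>)) (at (T \<xi>))"
    by (rule has_derivative_transform_within_open[OF _ open_image_T])
      (use assms in \<open>auto simp: psi_T T_inv_T\<close>)
  then show ?thesis by (simp add: gderiv_def)
qed

lemma grad_psi:
  assumes "\<xi> \<in> \<Omega>"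
  shows "grad \<psi> (T \<xi>) = (1 / (1 + \<alpha> * (\<xi> \<bullet> T \<xi>))) *\<^sub>R \<xi>"
  by (rule grad_eqI[OF GDERIV_psi[OF assms]])

lemma denominator_psi:
  assumes "\<xi> \<in> \<Omega>"
  shows "1 - \<alpha> * (grad \<psi> (T \<xi>) \<bullet> T \<xi>) = 1 / (1 + \<alpha> * (\<xi> \<bullet> T \<xi>))"
  using one_plus_inner_T_pos[OF assms assms] by (simp add: grad_psi[OF assms] field_simps)

lemma denominator_psi_pos:
  assumes "\<xi> \<in> \<Omega>"
  shows "1 - \<alpha> * (grad \<psi> (T \<xi>) \<bullet> T \<xi>) > 0"
  unfolding denominator_psi[OF assms]
  using one_plus_inner_T_pos[OF assms assms] by (rule divide_pos_pos[OF zero_less_one])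

text \<open>The denominator found in \<open>denominator_psi\<close> equals the scalar factor in
  \<open>grad_psi\<close>, so the quotient is \<open>\<xi>\<close>.\<close>

lemma alpha_grad_psi:
  assumes "\<xi> \<in> \<Omega>"
  shows "alpha_grad \<alpha> \<psi> (T \<xi>) = \<xi>"
  using one_plus_inner_T_pos[OF assms assms]
  unfolding alpha_grad_def[of \<alpha> \<psi>] denominator_psi[OF assms] unfolding grad_psi[OF assms] by simp

section \<open>Second derivative of the conjugate and positivity\<close>

lemma has_derivative_grad_psi:
  assumes "\<xi> \<in> \<Omega>"
  defines "q \<equiv> 1 + \<alpha> * (\<xi> \<bullet> T \<xi>)"
  shows "(grad \<psi> has_derivative (\<lambda>k. (1 / q) *\<^sub>R inv (DT \<xi>) k
    - (\<alpha> * (\<xi> \<bullet> k + inv (DT \<xi>) k \<bullet> T \<xi>) / q\<^sup>2) *\<^sub>R \<xi>)) (at (T \<xi>))"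
proof -
  let ?A = "inv (DT \<xi>)"
  have q: "q > 0" unfolding q_def by (rule one_plus_inner_T_pos[OF assms(1) assms(1)])
  have S': "(T_inv has_derivative ?A) (at (T \<xi>))" by (rule has_derivative_T_inv[OF assms(1)])
  have "((\<lambda>\<eta>. (1 / (1 + \<alpha> * (T_inv \<eta> \<bullet> \<eta>))) *\<^sub>R T_inv \<eta>) has_derivative
      (\<lambda>k. (1 / q) *\<^sub>R ?A k - (\<alpha> * (\<xi> \<bullet> k + ?A k \<bullet> T \<xi>) / q\<^sup>2) *\<^sub>R \<xi>)) (at (T \<xi>))"
    using q by (auto intro!: derivative_eq_intros S'
        simp: T_inv_T[OF assms(1)] q_def[symmetric] power2_eq_square)
  then show ?thesis
    by (rule has_derivative_transform_within_open[OF _ open_image_T])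
      (use assms in \<open>auto simp: grad_psi T_inv_T\<close>)
qed

text \<open>Testing on vectors \<open>DT \<xi> h\<close> and \<open>DT \<xi> k\<close> makes
  \<open>inv (DT \<xi>)\<close> disappear, so no formula for the inverse is required.\<close>

lemma exp_concavity_matrix_psi:
  assumes "\<xi> \<in> \<Omega>"
  shows "DT \<xi> h \<bullet> (exp_concavity_matrix \<alpha> \<psi> (T \<xi>) *v DT \<xi> k) = h \<bullet> (M \<xi> *v k)"
proof -
  define q where "q = 1 + \<alpha> * (\<xi> \<bullet> T \<xi>)"
  define m where "m = M \<xi> *v h"
  have q: "q > 0" unfolding q_def by (rule one_plus_inner_T_pos[OF assms assms])
  have inv: "inv (DT \<xi>) (DT \<xi> k) = k"
    by (rule inv_f_f[OF bij_is_inj[OF bij_DT[OF assms]]])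
  have "grad \<psi> differentiable (at (T \<xi>))"
    by (rule differentiableI[OF has_derivative_grad_psi[OF assms]])
  from fun_cong[OF has_derivative_unique[OF has_derivative_grad[OF this]
      has_derivative_grad_psi[OF assms]], of "DT \<xi> k"]
  have "hessian \<psi> (T \<xi>) *v DT \<xi> k
      = (1 / q) *\<^sub>R k - (\<alpha> * (\<xi> \<bullet> DT \<xi> k + k \<bullet> T \<xi>) / q\<^sup>2) *\<^sub>R \<xi>"
    by (simp only: inv q_def)
  \<comment> \<open>The rank-one term of the matrix cancels the part with
    \<open>\<xi> \<bullet> DT \<xi> k\<close>.\<close>
  then have N: "exp_concavity_matrix \<alpha> \<psi> (T \<xi>) *v DT \<xi> k
      = - (1 / q) *\<^sub>R (k - (\<alpha> * (k \<bullet> T \<xi>) / q) *\<^sub>R \<xi>)"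
    by (simp add: exp_concavity_matrix_mult grad_psi[OF assms] q_def[symmetric] algebra_simps
        power2_eq_square add_divide_distrib)
  have "DT \<xi> h = - q *\<^sub>R (m + (\<alpha> * (\<xi> \<bullet> m)) *\<^sub>R T \<xi>)"
    by (simp add: DT_def m_def q_def)
  then have "DT \<xi> h \<bullet> (exp_concavity_matrix \<alpha> \<psi> (T \<xi>) *v DT \<xi> k)
      = (m + (\<alpha> * (\<xi> \<bullet> m)) *\<^sub>R T \<xi>) \<bullet> (k - (\<alpha> * (k \<bullet> T \<xi>) / q) *\<^sub>R \<xi>)"
    using q unfolding N by simp
  \<comment> \<open>The left factor paired with \<open>\<xi>\<close> gives
    \<open>(\<xi> \<bullet> m) * q\<close>, so the last two terms cancel.\<close>
  also have "\<dots> = m \<bullet> k + \<alpha> * (\<xi> \<bullet> m) * (k \<bullet> T \<xi>)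
      - (\<alpha> * (k \<bullet> T \<xi>) / q) * ((\<xi> \<bullet> m) * q)"
    unfolding q_def by (simp add: inner_diff_right inner_add_left inner_commute algebra_simps)
  also have "\<dots> = k \<bullet> (M \<xi> *v h)"
    using q by (simp add: m_def inner_commute)
  \<comment> \<open>The computation ends with \<open>h\<close> and \<open>k\<close> exchanged;
    symmetry of \<open>M \<xi>\<close> swaps them back.\<close>
  finally show ?thesis
    using pos_definite_phi[OF assms] by (simp add: pos_definite_iff)
qed

text \<open>Since \<open>DT \<xi>\<close> is onto, the congruence reaches every pair of
  vectors.\<close>

lemma pos_definite_psi:
  assumes "\<xi> \<in> \<Omega>"
  shows "pos_definite (exp_concavity_matrix \<alpha> \<psi> (T \<xi>))"
  unfolding pos_definite_iff
proof (intro conjI allI impI)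
  let ?N = "exp_concavity_matrix \<alpha> \<psi> (T \<xi>)"
  have M: "pos_definite (M \<xi>)" by (rule pos_definite_phi[OF assms])
  have preimage: "\<exists>h. u = DT \<xi> h" for u
    using bij_is_surj[OF bij_DT[OF assms]] by (rule surjD)
  show "u \<bullet> (?N *v v) = v \<bullet> (?N *v u)" for u v
    using preimage[of u] preimage[of v] M by (auto simp: exp_concavity_matrix_psi[OF assms] pos_definite_iff)
  show "v \<bullet> (?N *v v) > 0" if "v \<noteq> 0" for v
  proof -
    obtain h where h: "v = DT \<xi> h" using preimage by blast
    then have "h \<noteq> 0" using that by (auto simp: DT_def)
    then show ?thesis using M by (simp add: h exp_concavity_matrix_psi[OF assms] pos_definite_iff)
  qed
qed

lemma twice_differentiable_psi:
  assumes "\<xi> \<in> \<Omega>"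
  shows "twice_differentiable_at \<psi> (T \<xi>)"
proof -
  have "\<psi> differentiable (at \<eta>)" if "\<eta> \<in> T ` \<Omega>" for \<eta>
    using that GDERIV_psi unfolding gderiv_def differentiable_def by blast
  then have "\<forall>\<^sub>F \<eta> in nhds (T \<xi>). \<psi> differentiable (at \<eta>)"
    using open_image_T assms unfolding eventually_nhds by blast
  then show ?thesis
    using has_derivative_grad_psi[OF assms]
    unfolding twice_differentiable_at_def differentiable_def by blast
qed

end

end

text \<open>Injectivity, positivity of the logarithm's argument and twice differentiability are
  asserted too, so that the conjugate, \<open>log_cost\<close>, \<open>grad \<psi>\<close> and
  \<open>hessian \<psi>\<close> carry their intended values.\<close>

theorem theorem8:
  fixes \<alpha> :: real
    and \<Omega> \<Omega>' :: "(real^'n) set"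
    and \<phi> \<psi> :: "real^'n \<Rightarrow> real"
  assumes "\<alpha> > 0"
    and "open \<Omega>"
    and "convex \<Omega>"
    and "exp_concave_on \<alpha> \<Omega> \<phi>"
    and "smooth_on \<Omega> \<phi>"
    and "\<And>\<xi>. \<xi> \<in> \<Omega> \<Longrightarrow> pos_definite (exp_concavity_matrix \<alpha> \<phi> \<xi>)"
    and "\<And>\<xi>. \<xi> \<in> \<Omega> \<Longrightarrow> 1 - \<alpha> * (grad \<phi> \<xi> \<bullet> \<xi>) > 0"
    and "\<Omega>' = alpha_grad \<alpha> \<phi> ` \<Omega>"
    and "\<And>\<eta>. \<eta> \<in> \<Omega>' \<Longrightarrow> \<psi> \<eta> = alpha_conjugate \<alpha> \<Omega> \<phi> \<eta>"
  shows "(open \<Omega>') \<and>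
    (inj_on (alpha_grad \<alpha> \<phi>) \<Omega>) \<and>
    (\<forall>\<xi>\<in>\<Omega>. \<forall>\<eta>\<in>\<Omega>'. 1 + \<alpha> * (\<xi> \<bullet> \<eta>) > 0) \<and>
    (\<forall>\<xi>\<in>\<Omega>. is_minimum (\<lambda>\<eta>'. log_cost \<alpha> \<xi> \<eta>' - \<psi> \<eta>') \<Omega>' (\<phi> \<xi>)) \<and>
    (\<forall>\<eta>\<in>\<Omega>'. is_minimum (\<lambda>\<xi>'. log_cost \<alpha> \<xi>' \<eta> - \<phi> \<xi>') \<Omega> (\<psi> \<eta>)) \<and>
    (\<forall>\<eta>\<in>\<Omega>'. twice_differentiable_at \<psi> \<eta>) \<and>
    (\<forall>\<eta>\<in>\<Omega>'. pos_definite (exp_concavity_matrix \<alpha> \<psi> \<eta>)) \<and>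
    (\<forall>\<eta>\<in>\<Omega>'. 1 - \<alpha> * (grad \<psi> \<eta> \<bullet> \<eta>) > 0) \<and>
    (\<forall>\<eta>\<in>\<Omega>'. inv_into \<Omega> (alpha_grad \<alpha> \<phi>) \<eta> = alpha_grad \<alpha> \<psi> \<eta>)"
proof -
  interpret regular_exp_concave \<alpha> \<Omega> \<phi>
    using assms smooth_on_imp_differentiable smooth_on_imp_grad_differentiable
    by unfold_locales blast+
  have conj: "\<psi> \<eta> = alpha_conjugate \<alpha> \<Omega> \<phi> \<eta>" if "\<eta> \<in> T ` \<Omega>" for \<eta>
    using assms(8,9) that by blast
  show ?thesis
    unfolding assms(8)
    using open_image_T inj_on_T one_plus_inner_T_pos is_minimum_phi[OF conj] is_minimum_psi[OF conj]
      twice_differentiable_psi[OF conj] pos_definite_psi[OF conj]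
      denominator_psi_pos[OF conj] alpha_grad_psi[OF conj] T_inv_T
    by auto
qed

end
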